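(* Let $\mathbb{P}$ and $\mathbb{V}$ be algebraic theories, with $\mathbb{P}$ consistent, $T_{\mathbb{P}}$ a stable universal set of $\mathbb{P}$-terms and $T_{\mathbb{V}}$ a stable universal set of $\mathbb{V}$-terms. Suppose there are terms $2 \vdash_{\mathbb{P}} p$ and $2 \vdash_{\mathbb{V}} v$ such that: (P1) $2 \vdash p(1,2) =_{\mathbb{P}} p(2,1)$; (P2) there is a substitution $f_p$ assigning to each variable of $p$ a term of $T_{\mathbb{P}}$ such that $\Gamma \vdash p(1, f_p(2)) =_{\mathbb{P}} 1$; (P3) for all $n \vdash p' \in T_{\mathbb{P}}$: if $n \vdash p(1,2) =_{\mathbb{P}} p'$ then $2 \vdash p'$; (V1) $1 \vdash v(1,1) =_{\mathbb{V}} 1$; (V2) for all $v' \in T_{\mathbb{V}}$ and each variable $x$: if $\Gamma \vdash x =_{\mathbb{V}} v'$ then $\{x\} \vdash v'$; (V3) for all $v' \in T_{\mathbb{V}}$: if $\Gamma \vdash v(1,2) =_{\mathbb{V}} v'$ then neither $\{1\}\vdash v'$ nor $\{2\} \vdash v'$. Then there is no composite theory of $\mathbb{P}$ after $\mathbb{V}$.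
   Context: An algebraic theory consists of a signature and equations; $=_{\mathbb T}$ is provable equality. Variables are natural numbers and $n$ also denotes $\{1,\dots,n\}$; $Y\vdash t$ means all variables of $t$ lie in $Y$; $\Gamma$ is an arbitrary variable context; $p(a,b)$ is $p$ with $a$ substituted for $1$ and $b$ for $2$. A theory is consistent if it does not prove $x=y$ for distinct variables. A set of terms is universal if every term is provably equal to a member, and stable if closed under substituting variables for variables. For theories $\mathbb{S},\mathbb{T}$ (here $\mathbb{T}=\mathbb{P}$, $\mathbb{S}=\mathbb{V}$): $\mathbb{U}$ contains them if its signature contains both signatures and their equations are provable in $\mathbb{U}$; a separated term is $t[s_x/x]$ with $t$ a $\mathbb{T}$-term with variables in $X$ and $s_x$ $\mathbb{S}$-terms; separated terms $t[s_x/x]$, $t'[s'_{x'}/x']$ are equal modulo $(\mathbb{T},\mathbb{S})$ if there are $f:X\to Y$, $f':X'\to Y$ and $\mathbb{S}$-terms $\bar s_y$ with $t[f(x)/x]=_{\mathbb T}t'[f'(x')/x']$, $s_x=_{\mathbb S}\bar s_{f(x)}$, $s'_{x'}=_{\mathbb S}\bar s_{f'(x')}$; $\mathbb{U}$ is a composite theory of $\mathbb{T}$ after $\mathbb{S}$ if every $\mathbb U$-term is $\mathbb U$-equal to a separated term and any two separated terms $\mathbb U$-equal to a common term are equal modulo $(\mathbb{T},\mathbb{S})$. *)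

theory Defs
  imports Main
begin

datatype 'f trm = Var nat | Op 'f "'f trm list"

text \<open>A signature is a set of operation symbols with arities; \<open>(f, m)\<close> and \<open>(f, n)\<close>
  count as different symbols for \<open>m \<noteq> n\<close>.\<close>

type_synonym 'f signature = "('f \<times> nat) set"

primrec vars :: "'f trm \<Rightarrow> nat set" where
  "vars (Var x) = {x}"
| "vars (Op f ts) = \<Union> (set (map vars ts))"

primrec subst :: "(nat \<Rightarrow> 'f trm) \<Rightarrow> 'f trm \<Rightarrow> 'f trm" where
  "subst \<sigma> (Var x) = \<sigma> x"
| "subst \<sigma> (Op f ts) = Op f (map (subst \<sigma>) ts)"

inductive_set terms :: "'f signature \<Rightarrow> 'f trm set" for F :: "'f signature" where
  Var: "Var x \<in> terms F"
| Op: "(f, length ts) \<in> F \<Longrightarrow> (\<And>t. t \<in> set ts \<Longrightarrow> t \<in> terms F) \<Longrightarrow> Op f ts \<in> terms F"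

record 'f theory_pres =
  sig :: "'f signature"
  eqns :: "('f trm \<times> 'f trm) set"

definition algebraic_theory :: "'f theory_pres \<Rightarrow> bool" where
  "algebraic_theory T \<longleftrightarrow> (\<forall>(l, r) \<in> eqns T. l \<in> terms (sig T) \<and> r \<in> terms (sig T))"

abbreviation terms_of :: "'f theory_pres \<Rightarrow> 'f trm set" where
  "terms_of T \<equiv> terms (sig T)"

inductive prov_eq :: "'f theory_pres \<Rightarrow> 'f trm \<Rightarrow> 'f trm \<Rightarrow> bool" for T :: "'f theory_pres" where
  refl: "t \<in> terms_of T \<Longrightarrow> prov_eq T t t"
| sym: "prov_eq T s t \<Longrightarrow> prov_eq T t s"
| trans: "prov_eq T s t \<Longrightarrow> prov_eq T t u \<Longrightarrow> prov_eq T s u"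
| cong: "(f, length ss) \<in> sig T \<Longrightarrow> list_all2 (prov_eq T) ss ts \<Longrightarrow> prov_eq T (Op f ss) (Op f ts)"
| axm: "(l, r) \<in> eqns T \<Longrightarrow> (\<And>x. \<sigma> x \<in> terms_of T) \<Longrightarrow> prov_eq T (subst \<sigma> l) (subst \<sigma> r)"

definition term_in_ctx :: "nat set \<Rightarrow> 'f theory_pres \<Rightarrow> 'f trm \<Rightarrow> bool"
  ("(_ \<turnstile>\<^bsub>_\<^esub> _)" [51, 0, 51] 50) where
  "\<Gamma> \<turnstile>\<^bsub>T\<^esub> t \<longleftrightarrow> t \<in> terms_of T \<and> vars t \<subseteq> \<Gamma>"

text \<open>It does not matter whether intermediate terms of a derivation must also lie in the context:
  as there is only one sort, variables outside \<open>\<Gamma>\<close> can be replaced by any term over \<open>\<Gamma>\<close>, and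
  \<open>s\<close> is one.\<close>

definition eq_in_ctx :: "nat set \<Rightarrow> 'f theory_pres \<Rightarrow> 'f trm \<Rightarrow> 'f trm \<Rightarrow> bool"
  ("(_ \<turnstile>\<^bsub>_\<^esub> _ \<approx> _)" [51, 0, 51, 51] 50) where
  "\<Gamma> \<turnstile>\<^bsub>T\<^esub> s \<approx> t \<longleftrightarrow> (\<Gamma> \<turnstile>\<^bsub>T\<^esub> s) \<and> (\<Gamma> \<turnstile>\<^bsub>T\<^esub> t) \<and> prov_eq T s t"

definition consistent :: "'f theory_pres \<Rightarrow> bool" where
  "consistent T \<longleftrightarrow> (\<forall>x y. x \<noteq> y \<longrightarrow> \<not> prov_eq T (Var x) (Var y))"

definition universal :: "'f theory_pres \<Rightarrow> 'f trm set \<Rightarrow> bool" where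
  "universal T A \<longleftrightarrow> A \<subseteq> terms_of T \<and> (\<forall>t \<in> terms_of T. \<exists>a \<in> A. prov_eq T t a)"

definition stable :: "'f trm set \<Rightarrow> bool" where
  "stable A \<longleftrightarrow> (\<forall>t \<in> A. \<forall>g :: nat \<Rightarrow> nat. subst (\<lambda>x. Var (g x)) t \<in> A)"

text \<open>\<open>subst2 t a b\<close> is $t(a,b)$.\<close>

definition subst2 :: "'f trm \<Rightarrow> 'f trm \<Rightarrow> 'f trm \<Rightarrow> 'f trm" where
  "subst2 t a b = subst (Var(1 := a, 2 := b)) t"

definition contains :: "'f theory_pres \<Rightarrow> 'f theory_pres \<Rightarrow> bool" where
  "contains U T \<longleftrightarrow> sig T \<subseteq> sig U \<and> (\<forall>(l, r) \<in> eqns T. prov_eq U l r)"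

text \<open>\<open>(X, t, s)\<close> presents the separated term \<open>subst s t\<close>. Only the values of \<open>s\<close> on \<open>X\<close> matter.\<close>

definition separated ::
  "'f theory_pres \<Rightarrow> 'f theory_pres \<Rightarrow> nat set \<Rightarrow> 'f trm \<Rightarrow> (nat \<Rightarrow> 'f trm) \<Rightarrow> bool" where
  "separated T S X t s \<longleftrightarrow> (X \<turnstile>\<^bsub>T\<^esub> t) \<and> (\<forall>x \<in> X. s x \<in> terms_of S)"

definition eq_modulo ::
  "'f theory_pres \<Rightarrow> 'f theory_pres \<Rightarrow> nat set \<Rightarrow> 'f trm \<Rightarrow> (nat \<Rightarrow> 'f trm) \<Rightarrow>
   nat set \<Rightarrow> 'f trm \<Rightarrow> (nat \<Rightarrow> 'f trm) \<Rightarrow> bool" where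
  "eq_modulo T S X t s X' t' s' \<longleftrightarrow>
     (\<exists>(Y :: nat set) (f :: nat \<Rightarrow> nat) (f' :: nat \<Rightarrow> nat) sbar.
        f ` X \<subseteq> Y \<and> f' ` X' \<subseteq> Y \<and> (\<forall>y \<in> Y. sbar y \<in> terms_of S) \<and>
        prov_eq T (subst (\<lambda>x. Var (f x)) t) (subst (\<lambda>x. Var (f' x)) t') \<and>
        (\<forall>x \<in> X. prov_eq S (s x) (sbar (f x))) \<and>
        (\<forall>x \<in> X'. prov_eq S (s' x) (sbar (f' x))))"

text \<open>\<open>composite U T S\<close>: \<open>U\<close> is a composite theory of \<open>T\<close> after \<open>S\<close>.\<close>

definition composite :: "'f theory_pres \<Rightarrow> 'f theory_pres \<Rightarrow> 'f theory_pres \<Rightarrow> bool" where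
  "composite U T S \<longleftrightarrow>
     algebraic_theory U \<and> contains U T \<and> contains U S \<and>
     (\<forall>u \<in> terms_of U. \<exists>X t s. separated T S X t s \<and> prov_eq U u (subst s t)) \<and>
     (\<forall>u \<in> terms_of U. \<forall>X t s X' t' s'.
        separated T S X t s \<longrightarrow> separated T S X' t' s' \<longrightarrow>
        prov_eq U u (subst s t) \<longrightarrow> prov_eq U u (subst s' t') \<longrightarrow>
        eq_modulo T S X t s X' t' s')"

end

theory Submission
  imports Defs
begin

text \<open>Suppose \<open>U\<close> is a composite of \<open>P\<close> after \<open>V\<close>, and write the term \<open>v(p(1,2), p(3,4))\<close> as a
  separated term \<open>t[s\<^sub>x/x]\<close> with \<open>t\<close> and all \<open>s\<^sub>x\<close> in the given universal sets. Identifying the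
  variables by \<open>3 \<mapsto> 1, 4 \<mapsto> 2\<close> or by \<open>3 \<mapsto> 2, 4 \<mapsto> 1\<close> turns it into \<open>p(1,2)\<close>, because \<open>p\<close> is
  commutative and \<open>v\<close> idempotent. Essential uniqueness and (P3) then say that every \<open>s\<^sub>x\<close> becomes
  equal to \<open>1\<close> or \<open>2\<close> under either identification, and by (V2) its variables collapse to a single one
  both times. Since the classes of the two identifications meet in one variable only, \<open>s\<^sub>x\<close> is
  itself equal to a variable, so \<open>v(p(1,2), p(3,4))\<close> is equal to a \<open>P\<close>-term. Substituting
  the terms of (P2) makes \<open>v(1,2)\<close> equal to a \<open>P\<close>-term. By essential uniqueness again and
  consistency of \<open>P\<close>, \<open>v(1,2)\<close> is then \<open>V\<close>-equal to a variable, which (V2) and (V3) exclude.\<close>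

declare One_nat_def [simp del]

section \<open>Substitution and provable equality\<close>

lemma subst_subst: "subst \<rho> (subst \<sigma> t) = subst (\<lambda>x. subst \<rho> (\<sigma> x)) t"
  by (induction t) auto

lemma subst_cong: "(\<And>x. x \<in> vars t \<Longrightarrow> \<sigma> x = \<tau> x) \<Longrightarrow> subst \<sigma> t = subst \<tau> t"
  by (induction t) auto

lemma subst_Var [simp]: "subst Var t = t"
  by (induction t) (auto intro: map_idI)

lemma subst_id: "(\<And>x. x \<in> vars t \<Longrightarrow> \<sigma> x = Var x) \<Longrightarrow> subst \<sigma> t = t"
  using subst_cong[of t \<sigma> Var] by simp

lemma vars_rename: "vars (subst (\<lambda>x. Var (g x)) t) = g ` vars t"
  by (induction t) auto

lemma subst_terms: "t \<in> terms F \<Longrightarrow> (\<And>x. x \<in> vars t \<Longrightarrow> \<sigma> x \<in> terms F) \<Longrightarrow> subst \<sigma> t \<in> terms F"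
proof (induction t rule: terms.induct)
  case (Op f ts)
  have "subst \<sigma> t \<in> terms F" if "t \<in> set ts" for t
    using Op.IH[OF that] Op.prems that by auto
  then show ?case
    using Op.hyps(1) by (auto intro!: terms.Op)
qed auto

lemma terms_mono: "t \<in> terms F \<Longrightarrow> F \<subseteq> G \<Longrightarrow> t \<in> terms G"
  by (induction t rule: terms.induct) (auto intro: terms.intros)

lemma prov_eq_subst:
  assumes "prov_eq T s t" and "\<And>x. \<sigma> x \<in> terms_of T"
  shows "prov_eq T (subst \<sigma> s) (subst \<sigma> t)"
  using assms(1)
proof induction
  case (refl t)
  then show ?case by (intro prov_eq.refl subst_terms assms(2))
next
  case (cong f ss ts)
  then show ?case
    by (auto intro!: prov_eq.cong simp: list_all2_conv_all_nth)
next
  case (axm l r \<tau>)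
  show ?case
    unfolding subst_subst by (rule prov_eq.axm) (use axm assms(2) in \<open>auto intro: subst_terms\<close>)
qed (auto intro: prov_eq.sym prov_eq.trans)

lemma prov_eq_rename:
  "prov_eq T s t \<Longrightarrow> prov_eq T (subst (\<lambda>x. Var (g x)) s) (subst (\<lambda>x. Var (g x)) t)"
  by (rule prov_eq_subst) (auto intro: terms.Var)

lemma prov_eq_subst_cong:
  assumes "t \<in> terms_of T" and "\<And>x. x \<in> vars t \<Longrightarrow> prov_eq T (\<sigma> x) (\<tau> x)"
  shows "prov_eq T (subst \<sigma> t) (subst \<tau> t)"
  using assms
proof (induction t rule: terms.induct)
  case (Op f ts)
  have "prov_eq T (subst \<sigma> t) (subst \<tau> t)" if "t \<in> set ts" for t
    using Op.IH[OF that] Op.prems that by auto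
  then show ?case
    using Op.hyps(1) by (auto intro!: prov_eq.cong simp: list_all2_conv_all_nth)
qed auto

lemma contains_terms: "contains U T \<Longrightarrow> t \<in> terms_of T \<Longrightarrow> t \<in> terms_of U"
  by (auto simp: contains_def intro: terms_mono)

lemma contains_prov_eq:
  assumes "contains U T" and "prov_eq T s t"
  shows "prov_eq U s t"
  using assms(2)
proof induction
  case (cong f ss ts)
  then show ?case
    using assms(1) by (auto intro!: prov_eq.cong simp: contains_def list_all2_conv_all_nth)
next
  \<comment> \<open>\<open>contains\<close> yields only the equation itself in \<open>U\<close>; its
    instances follow because provability is closed under substitution.\<close>
  case (axm l r \<sigma>)
  then show ?case
    using assms(1) by (intro prov_eq_subst contains_terms[OF assms(1)]) (auto simp: contains_def)
qed (auto intro: prov_eq.intros contains_terms[OF assms(1)])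

text \<open>If \<open>z\<close> did not occur in \<open>t\<close>, renaming \<open>z\<close> would
  leave \<open>t\<close> fixed and make it equal to two distinct variables.\<close>

lemma consistent_Var:
  assumes "consistent T" and "prov_eq T (Var z) t"
  shows "z \<in> vars t"
proof (rule ccontr)
  assume "z \<notin> vars t"
  then have eq: "subst (\<lambda>x. Var ((id(z := Suc z)) x)) t = t"
    by (intro subst_id) auto
  have "prov_eq T (Var (Suc z)) t"
    using prov_eq_rename[OF assms(2), of "id(z := Suc z)"] unfolding eq by simp
  then have "prov_eq T (Var z) (Var (Suc z))"
    using assms(2) by (blast intro: prov_eq.sym prov_eq.trans)
  then show False
    using assms(1) by (auto simp: consistent_def)
qed

lemma subst2_id: "vars t \<subseteq> {1..2} \<Longrightarrow> subst2 t (Var 1) (Var 2) = t"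
  unfolding subst2_def by (rule subst_id) auto

lemma subst_subst2:
  "vars t \<subseteq> {1..2} \<Longrightarrow> subst \<sigma> (subst2 t a b) = subst2 t (subst \<sigma> a) (subst \<sigma> b)"
  unfolding subst2_def subst_subst by (rule subst_cong) auto

lemma subst_subst2_Var:
  "vars t \<subseteq> {1..2} \<Longrightarrow> subst \<sigma> t = subst2 t (\<sigma> 1) (\<sigma> 2)"
  using subst_subst2[of t \<sigma> "Var 1" "Var 2"] by (simp add: subst2_id)

lemma subst2_terms:
  "t \<in> terms F \<Longrightarrow> a \<in> terms F \<Longrightarrow> b \<in> terms F \<Longrightarrow> subst2 t a b \<in> terms F"
  unfolding subst2_def by (rule subst_terms) (auto intro: terms.Var)

lemma prov_eq_subst2:
  "t \<in> terms_of T \<Longrightarrow> prov_eq T a a' \<Longrightarrow> prov_eq T b b' \<Longrightarrow>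
    prov_eq T (subst2 t a b) (subst2 t a' b')"
  unfolding subst2_def
  by (rule prov_eq_subst_cong) (auto intro: prov_eq.refl terms.Var)

section \<open>Separated terms over all variables\<close>

text \<open>This brings a separated form into the chosen universal sets, where hypotheses such as
  (P3) and (V2) can be applied, and makes the inner substitution total, so that contexts
  disappear.\<close>

lemma composite_separated:
  assumes "composite U T S" and "universal T TT" and "universal S TS" and "u \<in> terms_of U"
  obtains t s where "t \<in> TT" and "\<And>x. s x \<in> TS" and "prov_eq U u (subst s t)"
proof -
  have T: "contains U T" and S: "contains U S"
    using assms(1) by (auto simp: composite_def)
  obtain X t0 s0 where sep: "separated T S X t0 s0" and u: "prov_eq U u (subst s0 t0)"
    using assms(1,4) unfolding composite_def by meson
  have t0: "t0 \<in> terms_of T" and X: "vars t0 \<subseteq> X" and s0: "\<And>x. x \<in> X \<Longrightarrow> s0 x \<in> terms_of S"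
    using sep by (auto simp: separated_def term_in_ctx_def)
  \<comment> \<open>Off \<open>X\<close> nothing is known of \<open>s0\<close>, not even that its
    values are terms of \<open>S\<close>; variables serve as default there.\<close>
  define s1 where "s1 x = (if x \<in> X then s0 x else Var x)" for x
  have s1: "s1 x \<in> terms_of S" for x
    using s0 by (auto simp: s1_def intro: terms.Var)
  obtain t where t: "t \<in> TT" "prov_eq T t0 t"
    using assms(2) t0 by (auto simp: universal_def)
  have "\<exists>a \<in> TS. prov_eq S (s1 x) a" for x
    using assms(3) s1 by (auto simp: universal_def)
  then obtain s where s: "\<And>x. s x \<in> TS" "\<And>x. prov_eq S (s1 x) (s x)"
    by metis
  have "subst s0 t0 = subst s1 t0"
    using X by (intro subst_cong) (auto simp: s1_def)
  moreover have "prov_eq U (subst s1 t0) (subst s1 t)"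
    using contains_prov_eq[OF T t(2)] contains_terms[OF S s1] by (rule prov_eq_subst)
  moreover have "prov_eq U (subst s1 t) (subst s t)"
    using assms(2) t(1)
    by (intro prov_eq_subst_cong contains_terms[OF T] contains_prov_eq[OF S] s(2))
      (auto simp: universal_def)
  ultimately have "prov_eq U u (subst s t)"
    using u by (auto intro: prov_eq.trans)
  with t(1) s(1) show ?thesis
    by (rule that)
qed

text \<open>The mediating terms \<open>sbar\<close> are eliminated: indices sent to the same point
  have inner terms equal to the same \<open>sbar y\<close>, hence to each other. The last conclusion
  serves to show that \<open>f'\<close> separates indices with distinct inner terms.\<close>

lemma composite_unique:
  assumes "composite U T S" and "t \<in> terms_of T" and "t' \<in> terms_of T"
    and "\<And>x. s x \<in> terms_of S" and "\<And>x. s' x \<in> terms_of S"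
    and "prov_eq U (subst s t) (subst s' t')"
  obtains f f' where
    "prov_eq T (subst (\<lambda>x. Var (f x)) t) (subst (\<lambda>x. Var (f' x)) t')"
    and "\<And>x y. f x = f' y \<Longrightarrow> prov_eq S (s x) (s' y)"
    and "\<And>x y. f' x = f' y \<Longrightarrow> prov_eq S (s' x) (s' y)"
proof -
  have TU: "contains U T" and SU: "contains U S"
    using assms(1) by (auto simp: composite_def)
  \<comment> \<open>The first separated term itself plays the common term to which both are
    equal.\<close>
  have u: "subst s t \<in> terms_of U"
    by (intro subst_terms contains_terms[OF TU] contains_terms[OF SU] assms)
  have "separated T S UNIV t s" "separated T S UNIV t' s'"
    using assms by (auto simp: separated_def term_in_ctx_def)
  then have "eq_modulo T S UNIV t s UNIV t' s'"
    using assms(1,6) u prov_eq.refl[OF u] unfolding composite_def by blast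
  then obtain Y f f' sbar where eqs:
    "f ` UNIV \<subseteq> Y \<and> f' ` UNIV \<subseteq> Y \<and> (\<forall>y \<in> Y. sbar y \<in> terms_of S) \<and>
      prov_eq T (subst (\<lambda>x. Var (f x)) t) (subst (\<lambda>x. Var (f' x)) t') \<and>
      (\<forall>x \<in> UNIV. prov_eq S (s x) (sbar (f x))) \<and>
      (\<forall>x \<in> UNIV. prov_eq S (s' x) (sbar (f' x)))"
    unfolding eq_modulo_def by (elim exE) (rule that)
  have f: "prov_eq T (subst (\<lambda>x. Var (f x)) t) (subst (\<lambda>x. Var (f' x)) t')"
    and s: "prov_eq S (s x) (sbar (f x))" and s': "prov_eq S (s' x) (sbar (f' x))" for x
    using eqs by simp_all
  show ?thesis
  proof (rule that[OF f])
    show "prov_eq S (s x) (s' y)" if "f x = f' y" for x y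
      using s[of x] prov_eq.sym[OF s'[of y]] unfolding that by (rule prov_eq.trans)
    show "prov_eq S (s' x) (s' y)" if "f' x = f' y" for x y
      using s'[of x] prov_eq.sym[OF s'[of y]] unfolding that by (rule prov_eq.trans)
  qed
qed

section \<open>The no-go theorem\<close>

text \<open>A further renaming turns the right-hand side into \<open>p\<close> itself, and the
  left-hand side stays in \<open>TP\<close> by stability. A value of \<open>f\<close> other than
  \<open>f' 1\<close> and \<open>f' 2\<close> would then leave a variable that (P3) forbids.\<close>

lemma rename_vars_subset:
  assumes "stable TP" and "TP \<subseteq> terms_of P" and "t \<in> TP" and "{1..2} \<turnstile>\<^bsub>P\<^esub> p"
    and P3: "\<forall>n. \<forall>p' \<in> TP. ({1..n} \<turnstile>\<^bsub>P\<^esub> p') \<longrightarrow>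
               ({1..n} \<turnstile>\<^bsub>P\<^esub> subst2 p (Var 1) (Var 2) \<approx> p') \<longrightarrow> ({1..2} \<turnstile>\<^bsub>P\<^esub> p')"
    and eq: "prov_eq P (subst (\<lambda>x. Var (f x)) t) (subst (\<lambda>x. Var (f' x)) p)"
    and "f' 1 \<noteq> f' 2"
  shows "f ` vars t \<subseteq> {f' 1, f' 2}"
proof -
  have p: "p \<in> terms_of P" "vars p \<subseteq> {1..2}"
    using assms(4) by (auto simp: term_in_ctx_def)
  \<comment> \<open>All unwanted values go to the single variable 3, so that (P3) applies with
    \<open>n = 3\<close>.\<close>
  define h :: "nat \<Rightarrow> nat" where "h y = (if y = f' 1 then 1 else if y = f' 2 then 2 else 3)" for y
  define q where "q = subst (\<lambda>x. Var (h (f x))) t"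
  have vq: "vars q = (\<lambda>x. h (f x)) ` vars t"
    unfolding q_def by (rule vars_rename)
  have q: "q \<in> TP"
    using assms(1,3) by (simp add: q_def stable_def)
  have "subst (\<lambda>x. Var (h (f' x))) p = p"
    using p(2) \<open>f' 1 \<noteq> f' 2\<close> by (simp add: subst_subst2_Var h_def subst2_id)
  then have "prov_eq P q p"
    using prov_eq_rename[OF eq, of h] by (simp add: subst_subst q_def)
  moreover have "vars q \<subseteq> {1..3}"
    by (auto simp: vq h_def)
  moreover have "vars p \<subseteq> {1..3}"
    using p(2) by auto
  ultimately have "({1..3} \<turnstile>\<^bsub>P\<^esub> q)" "({1..3} \<turnstile>\<^bsub>P\<^esub> subst2 p (Var 1) (Var 2) \<approx> q)"
    using q assms(2) p by (auto simp: eq_in_ctx_def term_in_ctx_def subst2_id intro: prov_eq.sym)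
  then have "{1..2} \<turnstile>\<^bsub>P\<^esub> q"
    using P3 q by blast
  then have "h (f x) \<le> 2" if "x \<in> vars t" for x
    using that by (auto simp: term_in_ctx_def vq)
  then show ?thesis
    by (fastforce simp: h_def split: if_splits)
qed

theorem theorem3p21:
  fixes P V :: "'f theory_pres"
    and TP TV :: "'f trm set"
    and p v :: "'f trm"
  assumes "algebraic_theory P" and "algebraic_theory V"
    and "consistent P"
    and "universal P TP" and "stable TP"
    and "universal V TV" and "stable TV"
    and "{1..2} \<turnstile>\<^bsub>P\<^esub> p" and "{1..2} \<turnstile>\<^bsub>V\<^esub> v"
    and P1: "{1..2} \<turnstile>\<^bsub>P\<^esub> subst2 p (Var 1) (Var 2) \<approx> subst2 p (Var 2) (Var 1)"
    and P2: "\<exists>fp :: nat \<Rightarrow> 'f trm. (\<forall>x \<in> vars p. fp x \<in> TP) \<and>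
               (\<exists>\<Gamma>. \<Gamma> \<turnstile>\<^bsub>P\<^esub> subst2 p (Var 1) (fp 2) \<approx> Var 1)"
    and P3: "\<forall>n. \<forall>p' \<in> TP. ({1..n} \<turnstile>\<^bsub>P\<^esub> p') \<longrightarrow>
               ({1..n} \<turnstile>\<^bsub>P\<^esub> subst2 p (Var 1) (Var 2) \<approx> p') \<longrightarrow> ({1..2} \<turnstile>\<^bsub>P\<^esub> p')"
    and V1: "{1..1} \<turnstile>\<^bsub>V\<^esub> subst2 v (Var 1) (Var 1) \<approx> Var 1"
    and V2: "\<forall>v' \<in> TV. \<forall>x \<Gamma>. (\<Gamma> \<turnstile>\<^bsub>V\<^esub> Var x \<approx> v') \<longrightarrow> ({x} \<turnstile>\<^bsub>V\<^esub> v')"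
    and V3: "\<forall>v' \<in> TV. \<forall>\<Gamma>. (\<Gamma> \<turnstile>\<^bsub>V\<^esub> subst2 v (Var 1) (Var 2) \<approx> v') \<longrightarrow>
               \<not> ({1} \<turnstile>\<^bsub>V\<^esub> v') \<and> \<not> ({2} \<turnstile>\<^bsub>V\<^esub> v')"
  shows "\<not> (\<exists>U :: 'f theory_pres. composite U P V)"
proof
  assume "\<exists>U :: 'f theory_pres. composite U P V"
  then obtain U :: "'f theory_pres" where comp: "composite U P V" ..
  have PU: "contains U P" and VU: "contains U V"
    using comp by (auto simp: composite_def)
  have p: "p \<in> terms_of P" "vars p \<subseteq> {1..2}" and v: "v \<in> terms_of V" "vars v \<subseteq> {1..2}"
    using assms(8,9) by (auto simp: term_in_ctx_def)
  have TP: "TP \<subseteq> terms_of P" and TV: "TV \<subseteq> terms_of V"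
    using assms(4,6) by (auto simp: universal_def)
  have pU: "p \<in> terms_of U" and vU: "v \<in> terms_of U"
    using p v contains_terms[OF PU] contains_terms[OF VU] by auto
  have comm: "prov_eq P p (subst2 p (Var 2) (Var 1))"
    using P1 p by (simp add: eq_in_ctx_def subst2_id)
  have idem: "prov_eq V (subst2 v (Var 1) (Var 1)) (Var 1)"
    using V1 by (simp add: eq_in_ctx_def)
  have idemU: "prov_eq U (subst2 v a a) a" if "a \<in> terms_of U" for a
    using prov_eq_subst[OF contains_prov_eq[OF VU idem], of "\<lambda>_. a"] that v
    by (simp add: subst_subst2)

  \<comment> \<open>The term \<open>v\<close> is not equal to a variable\<close>
  have var_case: "vars a \<subseteq> {x}" if "a \<in> TV" "prov_eq V a (Var x)" for a x
  proof -
    have "(UNIV \<turnstile>\<^bsub>V\<^esub> Var x \<approx> a)"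
      using that TV by (auto simp: eq_in_ctx_def term_in_ctx_def intro: terms.Var prov_eq.sym)
    then show ?thesis
      using V2 that(1) by (auto simp: term_in_ctx_def)
  qed
  have v_not_12: False if "prov_eq V v (Var x)" "x = 1 \<or> x = 2" for x
  proof -
    obtain a where a: "a \<in> TV" "prov_eq V v a"
      using assms(6) v by (auto simp: universal_def)
    have "vars a \<subseteq> {x}"
      using prov_eq.trans[OF prov_eq.sym[OF a(2)] that(1)] by (rule var_case[OF a(1)])
    then have "({x} \<turnstile>\<^bsub>V\<^esub> a)"
      using a TV by (auto simp: term_in_ctx_def)
    moreover have "(UNIV \<turnstile>\<^bsub>V\<^esub> subst2 v (Var 1) (Var 2) \<approx> a)"
      using a v TV by (auto simp: eq_in_ctx_def term_in_ctx_def subst2_id)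
    ultimately show False
      using V3 a(1) that(2) by blast
  qed
  have v_not_var: "\<not> prov_eq V v (Var x)" for x
  proof
    assume x: "prov_eq V v (Var x)"
    show False
    proof (cases "x = 1 \<or> x = 2")
      \<comment> \<open>Here \<open>x\<close> does not occur in \<open>v\<close>, so renaming it to
        1 reduces to the case already excluded.\<close>
      case False
      then have "subst (\<lambda>y. Var ((id(x := 1)) y)) v = v"
        using v(2) by (intro subst_id) auto
      then have "prov_eq V v (Var 1)"
        using prov_eq_rename[OF x, of "id(x := 1)"] by simp
      then show False
        using v_not_12 by blast
    qed (use x v_not_12 in blast)
  qed
  \<comment> \<open>Consistency is assumed of \<open>P\<close>; for \<open>V\<close>, identifying 1
    and 2 would give v(1,2) = v(1,1) = 1.\<close>
  have V_12: "\<not> prov_eq V (Var 1) (Var 2)"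
  proof
    assume "prov_eq V (Var 1) (Var 2)"
    then have "prov_eq V (subst2 v (Var 1) (Var 2)) (subst2 v (Var 1) (Var 1))"
      using v(1) by (intro prov_eq_subst2) (auto intro: prov_eq.sym prov_eq.refl terms.Var)
    then have "prov_eq V v (Var 1)"
      using idem v(2) by (auto simp: subst2_id intro: prov_eq.trans)
    then show False
      using v_not_var by blast
  qed

  \<comment> \<open>The term \<open>w\<close> is equal to a term of \<open>P\<close>\<close>
  define w where "w = subst2 v (subst2 p (Var 1) (Var 2)) (subst2 p (Var 3) (Var 4))"
  have w: "w \<in> terms_of U"
    unfolding w_def by (intro subst2_terms vU pU terms.Var)
  have subst_w: "subst \<sigma> w = subst2 v (subst2 p (\<sigma> 1) (\<sigma> 2)) (subst2 p (\<sigma> 3) (\<sigma> 4))" for \<sigma>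
    using p v by (simp add: w_def subst_subst2)
  obtain t s where t: "t \<in> TP" and s: "\<And>x. s x \<in> TV" and wts: "prov_eq U w (subst s t)"
    using composite_separated[OF comp assms(4,6) w] by blast

  \<comment> \<open>Here \<open>g\<close> is any renaming that turns \<open>w\<close> into
    \<open>p\<close>, which covers both identifications. The bound on variables is used to intersect
    fibres; the equation is used to show that a term in one variable equals that variable.\<close>
  have collapse: "g ` vars (s x) \<subseteq> {1} \<or> g ` vars (s x) \<subseteq> {2}"
      "prov_eq V (subst (\<lambda>y. Var (g y)) (s x)) (Var 1) \<or>
       prov_eq V (subst (\<lambda>y. Var (g y)) (s x)) (Var 2)"
    if wg: "prov_eq U (subst (\<lambda>y. Var (g y)) w) p" and x: "x \<in> vars t" for g x
  proof -
    define sg where "sg x = subst (\<lambda>y. Var (g y)) (s x)" for x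
    have sg: "sg x \<in> TV" for x
      using assms(7) s by (auto simp: sg_def stable_def)
    \<comment> \<open>Two separated forms of \<open>p\<close>: the renamed form of \<open>w\<close>,
      and \<open>p\<close> with variables as inner terms.\<close>
    have "prov_eq U (subst sg t) (subst Var p)"
      using prov_eq.trans[OF prov_eq.sym[OF prov_eq_rename[OF wts, of g]] wg]
      by (simp add: subst_subst sg_def[abs_def])
    then obtain f f' where ff:
        "prov_eq P (subst (\<lambda>x. Var (f x)) t) (subst (\<lambda>x. Var (f' x)) p)"
      and eqs: "\<And>x y. f x = f' y \<Longrightarrow> prov_eq V (sg x) (Var y)"
      and f': "\<And>x y. f' x = f' y \<Longrightarrow> prov_eq V (Var x) (Var y)"
      using composite_unique[OF comp _ p(1), of t sg Var] t TP sg TV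
      by (metis subsetD terms.Var)
    have "f' 1 \<noteq> f' 2"
      using f' V_12 by blast
    then have "f ` vars t \<subseteq> {f' 1, f' 2}"
      using rename_vars_subset[OF assms(5) TP t assms(8) P3 ff] by blast
    then have sgx: "prov_eq V (sg x) (Var 1) \<or> prov_eq V (sg x) (Var 2)"
      using x eqs by blast
    then show "prov_eq V (subst (\<lambda>y. Var (g y)) (s x)) (Var 1) \<or>
       prov_eq V (subst (\<lambda>y. Var (g y)) (s x)) (Var 2)"
      by (simp add: sg_def)
    have "vars (sg x) \<subseteq> {1} \<or> vars (sg x) \<subseteq> {2}"
      using sgx var_case[OF sg] by blast
    then show "g ` vars (s x) \<subseteq> {1} \<or> g ` vars (s x) \<subseteq> {2}"
      by (simp add: sg_def vars_rename)
  qed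

  define g1 :: "nat \<Rightarrow> nat" where "g1 = id(3 := 1, 4 := 2)"
  define g2 :: "nat \<Rightarrow> nat" where "g2 = id(3 := 2, 4 := 1)"
  have w1: "prov_eq U (subst (\<lambda>y. Var (g1 y)) w) p"
    using idemU[OF pU] p by (simp add: subst_w g1_def subst2_id)
  have "prov_eq U (subst2 v p (subst2 p (Var 2) (Var 1))) (subst2 v p p)"
    using prov_eq.sym[OF contains_prov_eq[OF PU comm]]
    by (intro prov_eq_subst2 vU prov_eq.refl pU)
  then have w2: "prov_eq U (subst (\<lambda>y. Var (g2 y)) w) p"
    using idemU[OF pU] p by (auto simp: subst_w g2_def subst2_id intro: prov_eq.trans)

  have "\<exists>y. prov_eq V (s x) (Var y)" if x: "x \<in> vars t" for x
  proof -
    let ?A = "vars (s x)"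
    \<comment> \<open>These are the fibres of \<open>g1\<close> and \<open>g2\<close> over 1 and 2;
      each fibre of \<open>g1\<close> meets each fibre of \<open>g2\<close> in exactly one
      variable.\<close>
    have fib1: "g1 ` ?A \<subseteq> {1} \<Longrightarrow> ?A \<subseteq> {1, 3}" "g1 ` ?A \<subseteq> {2} \<Longrightarrow> ?A \<subseteq> {2, 4}"
      and fib2: "g2 ` ?A \<subseteq> {1} \<Longrightarrow> ?A \<subseteq> {1, 4}" "g2 ` ?A \<subseteq> {2} \<Longrightarrow> ?A \<subseteq> {2, 3}"
      by (auto simp: g1_def g2_def image_subset_iff split: if_splits)
    have "?A \<subseteq> {1, 3} \<or> ?A \<subseteq> {2, 4}" "?A \<subseteq> {1, 4} \<or> ?A \<subseteq> {2, 3}"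
      using collapse(1)[OF w1 x] fib1 collapse(1)[OF w2 x] fib2 by blast+
    moreover have "?A \<subseteq> {1, 3} \<Longrightarrow> ?A \<subseteq> {1, 4} \<Longrightarrow> ?A \<subseteq> {1}"
      "?A \<subseteq> {1, 3} \<Longrightarrow> ?A \<subseteq> {2, 3} \<Longrightarrow> ?A \<subseteq> {3}"
      "?A \<subseteq> {2, 4} \<Longrightarrow> ?A \<subseteq> {1, 4} \<Longrightarrow> ?A \<subseteq> {4}"
      "?A \<subseteq> {2, 4} \<Longrightarrow> ?A \<subseteq> {2, 3} \<Longrightarrow> ?A \<subseteq> {2}"
      by fastforce+
    ultimately obtain y where y: "?A \<subseteq> {y}"
      by metis
    \<comment> \<open>Containing only \<open>y\<close> does not yet make \<open>s x\<close> equal to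
      \<open>y\<close>. Its renaming by \<open>g1\<close> equals some variable; sending all
      variables to \<open>y\<close> in that equation restores \<open>s x\<close> on the left and
      gives \<open>y\<close> on the right.\<close>
    obtain z where "prov_eq V (subst (\<lambda>y. Var (g1 y)) (s x)) (Var z)"
      using collapse(2)[OF w1 x] by blast
    from prov_eq_rename[OF this, of "\<lambda>_. y"]
    have "prov_eq V (subst (\<lambda>_. Var y) (s x)) (Var y)"
      by (simp add: subst_subst)
    moreover have "subst (\<lambda>_. Var y) (s x) = s x"
      using y by (intro subst_id) auto
    ultimately show ?thesis
      by auto
  qed
  then obtain g where g: "\<And>x. x \<in> vars t \<Longrightarrow> prov_eq V (s x) (Var (g x))"
    by metis
  have "prov_eq U (subst s t) (subst (\<lambda>x. Var (g x)) t)"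
    using t TP g by (intro prov_eq_subst_cong contains_terms[OF PU] contains_prov_eq[OF VU]) auto
  with wts have wt: "prov_eq U w (subst (\<lambda>x. Var (g x)) t)"
    by (rule prov_eq.trans)

  \<comment> \<open>Substituting into \<open>w\<close> and the contradiction\<close>
  obtain c where c: "c \<in> terms_of P" and pc: "prov_eq P (subst2 p (Var 1) c) (Var 1)"
  proof -
    obtain fp \<Gamma> where fp: "\<forall>x \<in> vars p. fp x \<in> TP"
      and eq: "(\<Gamma> \<turnstile>\<^bsub>P\<^esub> subst2 p (Var 1) (fp 2) \<approx> Var 1)"
      using P2 by blast
    \<comment> \<open>(P2) makes \<open>fp 2\<close> a term of \<open>P\<close> only if 2 occurs in
      \<open>p\<close>; otherwise any term can replace it without changing the substitution
      instance.\<close>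
    define c where "c = (if 2 \<in> vars p then fp 2 else Var 1)"
    have "subst2 p (Var 1) c = subst2 p (Var 1) (fp 2)"
      unfolding subst2_def by (rule subst_cong) (auto simp: c_def)
    moreover have "c \<in> terms_of P"
      using fp TP by (auto simp: c_def intro: terms.Var)
    ultimately show ?thesis
      using eq that by (auto simp: eq_in_ctx_def)
  qed
  \<comment> \<open>Collapsing all variables of \<open>c\<close> to \<open>x\<close> turns p(1,c) =
    1 into p(x, d x) = x.\<close>
  define d where "d x = subst (\<lambda>_. Var x) c" for x
  have d: "d x \<in> terms_of P" for x
    using c by (auto simp: d_def intro: subst_terms terms.Var)
  have pd: "prov_eq U (subst2 p (Var x) (d x)) (Var x)" for x
    using prov_eq_rename[OF contains_prov_eq[OF PU pc], of "\<lambda>_. x"] p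
    by (simp add: d_def subst_subst2)
  \<comment> \<open>Under \<tau>, p(1,2) becomes p(1, d 1) = 1 and p(3,4) becomes p(2, d 2) = 2, so
    \<open>w\<close> becomes v(1,2).\<close>
  define \<tau> where "\<tau> = Var(2 := d 1, 3 := Var 2, 4 := d 2)"
  have \<tau>: "\<tau> x \<in> terms_of P" for x
    using d by (auto simp: \<tau>_def intro: terms.Var)
  define q where "q = subst (\<lambda>x. \<tau> (g x)) t"
  have q: "q \<in> terms_of P"
    unfolding q_def using t TP \<tau> by (intro subst_terms) auto
  have "prov_eq U (subst \<tau> w) q"
    using prov_eq_subst[OF wt, of \<tau>] contains_terms[OF PU \<tau>] by (simp add: subst_subst q_def)
  moreover have "prov_eq U (subst \<tau> w) (subst2 v (Var 1) (Var 2))"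
    unfolding subst_w by (intro prov_eq_subst2 vU) (use pd in \<open>auto simp: \<tau>_def\<close>)
  \<comment> \<open>Both sides are separated: a lone outer variable with inner term
    \<open>v\<close>, and the outer \<open>P\<close>-term \<open>q\<close> with variables as inner
    terms.\<close>
  ultimately have vq: "prov_eq U (subst (\<lambda>_. v) (Var 0)) (subst Var q)"
    using v(2) by (auto simp: subst2_id intro: prov_eq.sym prov_eq.trans)
  obtain f f' where
    f: "prov_eq P (subst (\<lambda>x. Var (f x)) (Var 0)) (subst (\<lambda>x. Var (f' x)) q)"
    and v_eq: "\<And>x y. f x = f' y \<Longrightarrow> prov_eq V v (Var y)"
    by (rule composite_unique[OF comp terms.Var q v(1) terms.Var vq]) (erule that, assumption)
  \<comment> \<open>By consistency the variable \<open>f 0\<close> must occur in the renamed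
    \<open>q\<close>, so \<open>f 0 = f' y\<close> for some \<open>y\<close>, which makes
    \<open>v\<close> equal to the variable \<open>y\<close>.\<close>
  have "f 0 \<in> f' ` vars q"
    using consistent_Var[OF assms(3)] f by (metis subst.simps(1) vars_rename)
  then show False
    using v_eq v_not_var by blast
qed

end
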